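(* If a transverse link $L\subset(S^3,\xi_{std})$ is the transverse stabilization of another transverse link, then $\psi(L)=0$ in $Kh(L)$.
   Context: **Transverse links and braids.** $\xi_{std}=\ker(dz-y\,dx+x\,dy)$ is the standard contact structure on $S^3$. A transverse link is a link everywhere transverse to $\xi_{std}$. Closed braids around the $z$-axis represent transverse links, and every transverse link is transversely isotopic to a closed braid. Braids on $b$ strings are words in $\sigma_1^{\pm1},\dots,\sigma_{b-1}^{\pm1}$; $\sigma_i$ gives a positive crossing between strings $i$ and $i+1$, and $\sigma_i^{-1}$ a negative one. The negative stabilization of a braid on $b$ strings is formed by adding a $(b+1)$-th string and multiplying the braid word by $\sigma_b^{-1}$. The transverse stabilization of a transverse link represented by a closed braid is the transverse link represented by the closure of the negative stabilization of that braid. **Khovanov complex (coefficients in $\mathbb{Z}$).** Let $L$ be an oriented link diagram with $n=n_++n_-$ crossings ($n_\pm$ positive/negative ones). Each crossing has a 0-resolution and a 1-resolution: the 0-resolution joins the two regions swept out when the overcrossing strand is rotated counterclockwise; in particular the oriented resolution of a positive crossing is its 0-resolution and the oriented resolution of a negative crossing is its 1-resolution. For $v\in\{0,1\}^n$ let $L_v$ be the corresponding complete resolution, a union of planar circles. Let $U$ be the free $\mathbb{Z}$-module with basis ${\bf u}_-,{\bf u}_+$, graded by $p({\bf u}_\pm)=\pm1$. If $L_v$ has $k$ circles put $CKh(L_v)=U^{\otimes k}$ (one factor per circle), and $CKh(L)=\bigoplus_v CKh(L_v)$. Homological grading: $\mathrm{gr}=|v|-n_-$, with $|v|$ the number of 1's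 in $v$; quantum grading: $q=p+\mathrm{gr}+n_+-n_-$. The differential on $CKh(L_v)$ is $d=\sum_e(-1)^{s(e)}d_e$ over edges $e$ of the cube $[0,1]^n$ with initial vertex $v$ (one coordinate changes from 0 to 1), where $d_e$ is $m$ on the factors of two circles that merge, or $\Delta$ on the factor of a circle that splits (identity on other factors): $m({\bf u}_+\otimes{\bf u}_+)={\bf u}_+$, $m({\bf u}_+\otimes{\bf u}_-)=m({\bf u}_-\otimes{\bf u}_+)={\bf u}_-$, $m({\bf u}_-\otimes{\bf u}_-)=0$; $\Delta({\bf u}_+)={\bf u}_+\otimes{\bf u}_-+{\bf u}_-\otimes{\bf u}_+$, $\Delta({\bf u}_-)={\bf u}_-\otimes{\bf u}_-$. The signs are chosen so that $d^2=0$ (all choices give isomorphic complexes). $Kh(L)$ is the bigraded homology. **The element $\psi(L)$.** For a closed braid diagram $L$ on $b$ strings let $L_o$ be the oriented resolution (0-resolution at positive crossings, 1-resolution at negative crossings), which consists of $b$ parallel circles. Put $\tilde\psi(L)={\bf u}_-\otimes\cdots\otimes{\bf u}_-\in U^{\otimes b}=CKh(L_o)$. It is a cycle, and $\psi(L)\in Kh(L)$ is its homology class. Up to sign and the canonical (up to sign) isomorphisms of Khovanov homology induced by isotopies, $\psi(L)$ depends only on the transverse link represented by the closed braid, so for a transverse link it may be computed from any closed braid representing it. *)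

theory Defs
  imports "HOL-Algebra.Free_Abelian_Groups"
begin

section \<open>Braid words and closed braid diagrams\<close>

datatype braid_letter =
    is_pos: Pos (strand: nat)  \<comment> \<open>the generator \<open>\<sigma>\<^sub>i\<close>: a positive crossing of strings \<open>i\<close> and \<open>i + 1\<close>\<close>
  | Neg (strand: nat)          \<comment> \<open>its inverse: a negative crossing of strings \<open>i\<close> and \<open>i + 1\<close>\<close>

type_synonym braid_word = "braid_letter list"

definition braid_word_on :: "nat \<Rightarrow> braid_word \<Rightarrow> bool" where
  "braid_word_on b w \<longleftrightarrow> 1 \<le> b \<and> (\<forall>g\<in>set w. 1 \<le> strand g \<and> strand g < b)"

text \<open>
  Every transverse link is represented by a closed braid. The transverse stabilization of the link
  represented by the closure of \<open>w\<close>, a word on \<open>b\<close> strings, is the link represented by the closure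
  of the following word on \<open>b + 1\<close> strings.
\<close>

definition negative_stabilization :: "nat \<Rightarrow> braid_word \<Rightarrow> braid_word" where
  "negative_stabilization b w = w @ [Neg b]"

definition n_plus :: "braid_word \<Rightarrow> nat" where
  "n_plus w = card {c. c < length w \<and> is_pos (w ! c)}"

definition n_minus :: "braid_word \<Rightarrow> nat" where
  "n_minus w = card {c. c < length w \<and> \<not> is_pos (w ! c)}"


section \<open>Complete resolutions\<close>

text \<open>
  Crossings of the closure of \<open>w\<close> are numbered \<open>0, \<dots>, length w - 1\<close>. A vertex of the cube of
  resolutions is given by the set \<open>v\<close> of the crossings that receive the 1-resolution.

  The closed braid is cut at the levels \<open>0, \<dots>, length w\<close>, with crossing \<open>c\<close> lying between the
  levels \<open>c\<close> and \<open>c + 1\<close>; the cut point \<open>(k, j)\<close> is the one in position \<open>j\<close> at level \<open>k\<close>. A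
  complete resolution is a union of arcs between cut points: the closing arcs, the arcs that pass
  by a crossing, and the two arcs replacing each crossing. The oriented resolution of a crossing
  of strings \<open>i\<close>, \<open>i + 1\<close> consists of two parallel vertical arcs, the other resolution of two
  horizontal ones. A circle is represented by the set of cut points on it.
\<close>

type_synonym cut_point = "nat \<times> nat"
type_synonym circle = "cut_point set"

definition vertices :: "braid_word \<Rightarrow> nat set set" where
  "vertices w = Pow {..<length w}"

definition oriented_at :: "braid_word \<Rightarrow> nat set \<Rightarrow> nat \<Rightarrow> bool" where
  "oriented_at w v c \<longleftrightarrow> (if is_pos (w ! c) then c \<notin> v else c \<in> v)"

definition cut_points :: "nat \<Rightarrow> braid_word \<Rightarrow> cut_point set" where
  "cut_points b w = {0..length w} \<times> {1..b}"

definition crossing_arcs ::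
    "nat \<Rightarrow> braid_word \<Rightarrow> nat set \<Rightarrow> nat \<Rightarrow> (cut_point \<times> cut_point) set" where
  "crossing_arcs b w v c =
     (let i = strand (w ! c) in
        {((c, j), (Suc c, j)) | j. j \<in> {1..b} - {i, Suc i}} \<union>
        (if oriented_at w v c
         then {((c, i), (Suc c, i)), ((c, Suc i), (Suc c, Suc i))}
         else {((c, i), (c, Suc i)), ((Suc c, i), (Suc c, Suc i))}))"

definition arcs :: "nat \<Rightarrow> braid_word \<Rightarrow> nat set \<Rightarrow> (cut_point \<times> cut_point) set" where
  "arcs b w v =
     {((length w, j), (0, j)) | j. j \<in> {1..b}} \<union> (\<Union>c<length w. crossing_arcs b w v c)"

definition circles :: "nat \<Rightarrow> braid_word \<Rightarrow> nat set \<Rightarrow> circle set" where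
  "circles b w v = cut_points b w // (arcs b w v \<union> (arcs b w v)\<inverse>)\<^sup>*"


section \<open>The Khovanov complex\<close>

text \<open>
  A basis element of the tensor power of \<open>U\<close> attached to a vertex \<open>v\<close> assigns \<open>u\<^sub>+\<close> or \<open>u\<^sub>-\<close> to each
  circle. It is encoded as a pair \<open>(v, P)\<close>, where \<open>P\<close> is the set of circles that carry \<open>u\<^sub>+\<close>. The
  chain groups are the free abelian groups on these pairs.
\<close>

type_synonym gen = "nat set \<times> circle set"

definition generators :: "nat \<Rightarrow> braid_word \<Rightarrow> gen set" where
  "generators b w = (SIGMA v:vertices w. Pow (circles b w v))"

fun p_grading :: "nat \<Rightarrow> braid_word \<Rightarrow> gen \<Rightarrow> int" where
  "p_grading b w (v, P) = int (card P) - int (card (circles b w v - P))"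

fun gr_grading :: "braid_word \<Rightarrow> gen \<Rightarrow> int" where
  "gr_grading w (v, P) = int (card v) - int (n_minus w)"

definition q_grading :: "nat \<Rightarrow> braid_word \<Rightarrow> gen \<Rightarrow> int" where
  "q_grading b w g = p_grading b w g + gr_grading w g + int (n_plus w) - int (n_minus w)"

definition CKh :: "nat \<Rightarrow> braid_word \<Rightarrow> (gen \<Rightarrow>\<^sub>0 int) monoid" where
  "CKh b w = free_Abelian_group (generators b w)"

definition CKh_at :: "nat \<Rightarrow> braid_word \<Rightarrow> int \<Rightarrow> int \<Rightarrow> (gen \<Rightarrow>\<^sub>0 int) monoid" where
  "CKh_at b w i q =
     free_Abelian_group {g \<in> generators b w. gr_grading w g = i \<and> q_grading b w g = q}"

text \<open>
  The map \<open>d\<^sub>e\<close> for the edge from \<open>v\<close> to \<open>v \<union> {c}\<close>. Circles not involved in the merge or split are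
  the common elements of the two sets of circles and keep their labels; \<open>old\<close> consists of the two
  circles that merge or the single circle that splits, and \<open>new\<close> of the circle or circles
  replacing them. The first three cases are the multiplication \<open>m\<close> with two, one and no factors
  \<open>u\<^sub>+\<close>, the last two are \<open>\<Delta>(u\<^sub>+)\<close> and \<open>\<Delta>(u\<^sub>-)\<close>.
\<close>

fun edge_map :: "nat \<Rightarrow> braid_word \<Rightarrow> nat \<Rightarrow> gen \<Rightarrow> (gen \<Rightarrow>\<^sub>0 int)" where
  "edge_map b w c (v, P) =
     (let v' = insert c v;
          old = circles b w v - circles b w v';
          new = circles b w v' - circles b w v;
          Q = P \<inter> circles b w v'
      in if card old = 2
         then if old \<subseteq> P then frag_of (v', Q \<union> new)
              else if old \<inter> P \<noteq> {} then frag_of (v', Q)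
              else 0
         else if old \<subseteq> P then (\<Sum>C\<in>new. frag_of (v', insert C Q))
              else frag_of (v', Q))"

text \<open>
  For \<open>c \<notin> v\<close> the edge from \<open>v\<close> to \<open>v \<union> {c}\<close> is given the sign \<open>(-1) ^ s v c\<close>.
\<close>

definition differential ::
    "nat \<Rightarrow> braid_word \<Rightarrow> (nat set \<Rightarrow> nat \<Rightarrow> nat) \<Rightarrow> (gen \<Rightarrow>\<^sub>0 int) \<Rightarrow> (gen \<Rightarrow>\<^sub>0 int)" where
  "differential b w s =
     frag_extend (\<lambda>g. \<Sum>c\<in>{..<length w} - fst g. frag_cmul ((-1) ^ s (fst g) c) (edge_map b w c g))"

definition sign_choice :: "nat \<Rightarrow> braid_word \<Rightarrow> (nat set \<Rightarrow> nat \<Rightarrow> nat) \<Rightarrow> bool" where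
  "sign_choice b w s \<longleftrightarrow>
     (\<forall>x\<in>carrier (CKh b w). differential b w s (differential b w s x) = 0)"


section \<open>Khovanov homology and the transverse element\<close>

definition cycles ::
    "nat \<Rightarrow> braid_word \<Rightarrow> (nat set \<Rightarrow> nat \<Rightarrow> nat) \<Rightarrow> int \<Rightarrow> int \<Rightarrow> (gen \<Rightarrow>\<^sub>0 int) set" where
  "cycles b w s i q = kernel (CKh_at b w i q) (CKh_at b w (i + 1) q) (differential b w s)"

definition boundaries ::
    "nat \<Rightarrow> braid_word \<Rightarrow> (nat set \<Rightarrow> nat \<Rightarrow> nat) \<Rightarrow> int \<Rightarrow> int \<Rightarrow> (gen \<Rightarrow>\<^sub>0 int) set" where
  "boundaries b w s i q = differential b w s ` carrier (CKh_at b w (i - 1) q)"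

definition Kh ::
    "nat \<Rightarrow> braid_word \<Rightarrow> (nat set \<Rightarrow> nat \<Rightarrow> nat) \<Rightarrow> int \<Rightarrow> int \<Rightarrow> (gen \<Rightarrow>\<^sub>0 int) set monoid" where
  "Kh b w s i q = subgroup_generated (CKh_at b w i q) (cycles b w s i q) Mod boundaries b w s i q"

definition oriented_vertex :: "braid_word \<Rightarrow> nat set" where
  "oriented_vertex w = {c. c < length w \<and> \<not> is_pos (w ! c)}"

definition psi_gen :: "braid_word \<Rightarrow> gen" where
  "psi_gen w = (oriented_vertex w, {})"

text \<open>
  Up to sign and canonical isomorphism of Khovanov homology, the class \<open>psi\<close> of a closed braid
  depends only on the transverse link it represents; for a transverse link it is computed from a
  closed braid representing it. The bidegree of its chain representative is
  \<open>(0, n\<^sub>+ - n\<^sub>- - b)\<close>.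
\<close>

definition psi_gr :: "braid_word \<Rightarrow> int" where
  "psi_gr w = gr_grading w (psi_gen w)"

definition psi_q :: "nat \<Rightarrow> braid_word \<Rightarrow> int" where
  "psi_q b w = q_grading b w (psi_gen w)"

definition psi ::
    "nat \<Rightarrow> braid_word \<Rightarrow> (nat set \<Rightarrow> nat \<Rightarrow> nat) \<Rightarrow> (gen \<Rightarrow>\<^sub>0 int) set" where
  "psi b w s =
     boundaries b w s (psi_gr w) (psi_q b w)
       #>\<^bsub>CKh_at b w (psi_gr w) (psi_q b w)\<^esub> frag_of (psi_gen w)"

end

theory Submission
  imports Defs
begin

text \<open>
  Switching the stabilizing crossing to its 0-resolution merges the last two of the parallel
  circles of the oriented resolution. Label every circle of the vertex \<open>v\<close> obtained in this way
  by \<open>u\<^sub>-\<close>. The edge at the stabilizing crossing splits the merged circle again and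
  \<open>\<Delta>(u\<^sub>-) = u\<^sub>- \<otimes> u\<^sub>-\<close>, so it contributes the cycle representing \<open>\<psi>\<close> up to sign. Every other edge
  out of \<open>v\<close> belongs to a positive crossing of the original braid and merges two distinct circles,
  hence contributes \<open>m(u\<^sub>- \<otimes> u\<^sub>-) = 0\<close>. Thus \<open>\<psi>\<close> is represented by a boundary.
\<close>

section \<open>Circles of a resolution\<close>

abbreviation connected_in :: "nat \<Rightarrow> braid_word \<Rightarrow> nat set \<Rightarrow> (cut_point \<times> cut_point) set" where
  "connected_in b w v \<equiv> (arcs b w v \<union> (arcs b w v)\<inverse>)\<^sup>*"

lemma sym_connected_in: "sym (connected_in b w v)"
  by (intro sym_rtrancl sym_Un_converse)

lemma connected_in_sym: "(x, y) \<in> connected_in b w v \<Longrightarrow> (y, x) \<in> connected_in b w v"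
  using sym_connected_in by (rule symD)

lemma arc_connected_in: "(x, y) \<in> arcs b w v \<Longrightarrow> (x, y) \<in> connected_in b w v"
  by blast

text \<open>Bounds a circle from above by an explicit set: a path cannot leave a set whose border no
  arc crosses.\<close>

lemma connected_in_closed:
  assumes "(x, y) \<in> connected_in b w v" and "x \<in> S"
    and closed: "\<And>x y. (x, y) \<in> arcs b w v \<Longrightarrow> x \<in> S \<longleftrightarrow> y \<in> S"
  shows "y \<in> S"
  using assms(1,2) by (induction rule: rtrancl_induct) (auto dest: closed)

lemma circlesE:
  assumes "C \<in> circles b w v"
  obtains x where "x \<in> cut_points b w" "C = connected_in b w v `` {x}"
  using assms unfolding circles_def by (auto elim: quotientE)

lemma circle_eq:
  assumes "C \<in> circles b w v" and "x \<in> C"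
  shows "C = connected_in b w v `` {x}"
proof -
  obtain y where C: "C = connected_in b w v `` {y}" using assms(1) by (rule circlesE)
  then have "(y, x) \<in> connected_in b w v" using assms(2) by simp
  then show ?thesis
    unfolding C using connected_in_sym by (blast intro: rtrancl_trans)
qed

lemma circle_arc_closed:
  assumes "C \<in> circles b w v" and "(x, y) \<in> arcs b w v" and "x \<in> C"
  shows "y \<in> C"
  using circle_eq[OF assms(1,3)] arc_connected_in[OF assms(2)] by blast

text \<open>Circles partition the cut points, so circles that already cover everything leave no room
  for another.\<close>

lemma circles_eqI:
  assumes sub: "F \<subseteq> circles b w v" and cover: "cut_points b w \<subseteq> \<Union>F"
  shows "circles b w v = F"
proof
  show "circles b w v \<subseteq> F"
  proof
    fix C assume "C \<in> circles b w v"
    then obtain x where x: "x \<in> cut_points b w" "C = connected_in b w v `` {x}"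
      by (rule circlesE)
    then obtain D where "D \<in> F" "x \<in> D" using cover by blast
    then show "C \<in> F" using circle_eq[of D b w v x] sub x(2) by auto
  qed
qed (rule sub)

section \<open>Arcs and paths along the strings\<close>

lemma vertical_arc:
  assumes "c < length w" and "j \<in> {1..b}"
    and "oriented_at w v c \<or> j \<notin> {strand (w ! c), Suc (strand (w ! c))}"
  shows "((c, j), (Suc c, j)) \<in> arcs b w v"
  using assms unfolding arcs_def crossing_arcs_def Let_def by auto

lemma closing_arc: "j \<in> {1..b} \<Longrightarrow> ((length w, j), (0, j)) \<in> arcs b w v"
  unfolding arcs_def by auto

lemma horizontal_arcs:
  assumes "c < length w" and "\<not> oriented_at w v c"
  shows "((c, strand (w ! c)), (c, Suc (strand (w ! c)))) \<in> arcs b w v"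
    and "((Suc c, strand (w ! c)), (Suc c, Suc (strand (w ! c)))) \<in> arcs b w v"
  using assms unfolding arcs_def crossing_arcs_def Let_def by auto

lemma connected_in_vertical:
  assumes "k \<le> l"
    and "\<And>i. k \<le> i \<Longrightarrow> i < l \<Longrightarrow> ((i, j), (Suc i, j)) \<in> arcs b w v"
  shows "((k, j), (l, j)) \<in> connected_in b w v"
  using assms
proof (induction l rule: dec_induct)
  case (step l)
  then have "((k, j), (l, j)) \<in> connected_in b w v" by simp
  moreover have "((l, j), (Suc l, j)) \<in> connected_in b w v"
    using step by (intro arc_connected_in) simp
  ultimately show ?case by (rule rtrancl_trans)
qed simp

text \<open>A string that is cut at most once stays connected because of its closing arc.\<close>

lemma column_connected:
  assumes j: "j \<in> {1..b}" and "k \<le> length w"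
    and vert: "\<And>i. i < length w \<Longrightarrow> i \<noteq> c \<Longrightarrow> ((i, j), (Suc i, j)) \<in> arcs b w v"
  shows "((0, j), (k, j)) \<in> connected_in b w v"
proof (cases "k \<le> c")
  case True
  then show ?thesis using assms(2) by (intro connected_in_vertical vert) auto
next
  case False
  then have "((k, j), (length w, j)) \<in> connected_in b w v"
    using assms(2) by (intro connected_in_vertical vert) auto
  then have "((k, j), (0, j)) \<in> connected_in b w v"
    using arc_connected_in[OF closing_arc[OF j]] by (rule rtrancl_trans)
  then show ?thesis by (rule connected_in_sym)
qed

text \<open>Only horizontal arcs change the column, so whether a union of full columns is closed
  depends only on the crossings not resolved in the oriented way.\<close>

lemma arcs_columns:
  assumes "((k, j), (k', j')) \<in> arcs b w v"
  shows "j = j' \<or> (\<exists>c<length w. \<not> oriented_at w v c \<and> j = strand (w ! c) \<and> j' = Suc j)"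
  using assms unfolding arcs_def crossing_arcs_def Let_def by (auto split: if_splits)

lemma arcs_levels:
  assumes "((k, j), (k', j')) \<in> arcs b w v"
  shows "k \<le> length w" "k' \<le> length w"
  using assms unfolding arcs_def crossing_arcs_def Let_def by (auto split: if_splits)

text \<open>\<open>closed\<close> keeps the component of \<open>(0, a)\<close> inside the columns
  \<open>A\<close>, and \<open>conn\<close> makes it fill them.\<close>

lemma columns_circle:
  assumes A: "A \<subseteq> {1..b}" and a: "a \<in> A"
    and closed: "\<And>c. c < length w \<Longrightarrow> \<not> oriented_at w v c \<Longrightarrow>
      strand (w ! c) \<in> A \<longleftrightarrow> Suc (strand (w ! c)) \<in> A"
    and conn: "\<And>k j. k \<le> length w \<Longrightarrow> j \<in> A \<Longrightarrow> ((0, a), (k, j)) \<in> connected_in b w v"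
  shows "{0..length w} \<times> A \<in> circles b w v"
proof -
  have "connected_in b w v `` {(0, a)} = {0..length w} \<times> A"
  proof (intro equalityI subsetI)
    fix y assume "y \<in> connected_in b w v `` {(0, a)}"
    then have "((0, a), y) \<in> connected_in b w v" by simp
    then show "y \<in> {0..length w} \<times> A"
    proof (rule connected_in_closed)
      fix x y assume xy: "(x, y) \<in> arcs b w v"
      obtain k j k' j' where [simp]: "x = (k, j)" "y = (k', j')" by fastforce
      show "x \<in> {0..length w} \<times> A \<longleftrightarrow> y \<in> {0..length w} \<times> A"
        using arcs_levels[of k j k' j' b w v] arcs_columns[of k j k' j' b w v] xy closed by auto
    qed (use a in auto)
  qed (use conn in auto)
  moreover have "(0, a) \<in> cut_points b w" using A a by (auto simp: cut_points_def)
  ultimately show ?thesis unfolding circles_def by (metis quotientI)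
qed

lemma column_circle:
  assumes "j \<in> {1..b}"
    and "\<And>c. c < length w \<Longrightarrow> \<not> oriented_at w v c \<Longrightarrow> j \<noteq> strand (w ! c) \<and> j \<noteq> Suc (strand (w ! c))"
  shows "{0..length w} \<times> {j} \<in> circles b w v"
proof (rule columns_circle)
  \<comment> \<open>\<open>length w\<close> is not a crossing, so taking it as the excluded level
    leaves the column uncut.\<close>
  show "((0, j), (k, i)) \<in> connected_in b w v" if "k \<le> length w" "i \<in> {j}" for k i
    using that assms column_connected[OF assms(1) that(1), where c = "length w"] vertical_arc[of _ w j b v]
    by blast
qed (use assms in force)+


section \<open>The edge maps at labels without any plus\<close>

lemma edge_map_merge_minus:
  assumes "card (circles b w v - circles b w (insert c v)) = 2"
  shows "edge_map b w c (v, {}) = 0"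
proof -
  \<comment> \<open>A nonempty \<open>old\<close> rules out \<open>old \<subseteq> {}\<close>, which
    would select the case of two factors u+.\<close>
  have "circles b w v - circles b w (insert c v) \<noteq> {}" using assms by force
  then show ?thesis using assms by (simp add: Let_def)
qed

text \<open>\<Delta>(u-) = u- \<otimes> u-: the new circles carry u-, so the set of plus circles
  stays empty.\<close>

lemma edge_map_split_minus:
  assumes "card (circles b w v - circles b w (insert c v)) = 1"
  shows "edge_map b w c (v, {}) = frag_of (insert c v, {})"
proof -
  have "circles b w v - circles b w (insert c v) \<noteq> {}" using assms by force
  then show ?thesis using assms by (simp add: Let_def)
qed


section \<open>The vertex next to the oriented one\<close>

locale stabilization =
  fixes b :: nat and w L :: braid_word
  assumes word: "braid_word_on b w"
    and L_eq: "L = negative_stabilization b w"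
begin

abbreviation "n \<equiv> length w"

abbreviation column :: "nat \<Rightarrow> circle" where
  "column j \<equiv> {0..length L} \<times> {j}"

definition merged :: circle where
  "merged = {0..length L} \<times> {b, Suc b}"

text \<open>Crossing \<open>n\<close> is the appended \<open>Neg b\<close>. Being negative, it has
  the 1-resolution as its oriented one, so removing \<open>n\<close> steps back along an edge of the
  cube that ends at the oriented vertex.\<close>

definition adjacent :: "nat set" where
  "adjacent = oriented_vertex L - {n}"

section \<open>Crossings and vertices of the stabilized word\<close>

lemma b_pos: "1 \<le> b"
  using word by (simp add: braid_word_on_def)

lemma length_L: "length L = Suc n"
  by (simp add: L_eq negative_stabilization_def)

lemma nth_last [simp]: "L ! n = Neg b"
  by (simp add: L_eq negative_stabilization_def)

lemma strand_less:
  assumes "c < n"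
  shows "1 \<le> strand (L ! c)" "strand (L ! c) < b"
  using word assms by (auto simp: L_eq negative_stabilization_def braid_word_on_def nth_append)

lemma last_in_oriented_vertex: "n \<in> oriented_vertex L"
  by (simp add: oriented_vertex_def length_L)

lemma insert_adjacent: "insert n adjacent = oriented_vertex L"
  using last_in_oriented_vertex by (auto simp: adjacent_def)

lemma oriented_at_oriented_vertex: "c < length L \<Longrightarrow> oriented_at L (oriented_vertex L) c"
  by (simp add: oriented_at_def oriented_vertex_def)

lemma oriented_at_adjacent: "c < length L \<Longrightarrow> oriented_at L adjacent c \<longleftrightarrow> c \<noteq> n"
  by (auto simp: oriented_at_def oriented_vertex_def adjacent_def)

text \<open>A crossing \<open>c < n\<close> outside \<open>adjacent\<close> is positive, so its
  1-resolution is horizontal; crossing \<open>n\<close> was horizontal before.\<close>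

lemma oriented_at_insert_adjacent:
  assumes "c \<notin> adjacent" "c < n" "k < length L"
  shows "oriented_at L (insert c adjacent) k \<longleftrightarrow> k \<noteq> c \<and> k \<noteq> n"
  using assms by (auto simp: oriented_at_def oriented_vertex_def adjacent_def length_L)

lemma column_neq_merged: "column j \<noteq> merged"
proof -
  have "(0, b) \<in> merged" "(0, Suc b) \<in> merged" by (auto simp: merged_def)
  moreover have "(0, b) \<notin> column j \<or> (0, Suc b) \<notin> column j" by auto
  ultimately show ?thesis by blast
qed

lemma column_eq_iff: "column i = column j \<longleftrightarrow> i = j"
  by auto

section \<open>Circles at the oriented vertex and at \<open>adjacent\<close>\<close>

lemma circles_oriented_vertex: "circles (b + 1) L (oriented_vertex L) = column ` {1..b + 1}"
proof (rule circles_eqI)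
  show "column ` {1..b + 1} \<subseteq> circles (b + 1) L (oriented_vertex L)"
    by (auto intro!: column_circle simp: oriented_at_oriented_vertex)
qed (auto simp: cut_points_def)

text \<open>Stated for a general vertex since it serves \<open>adjacent\<close> and also the
  vertices reached from it by an edge away from string \<open>b\<close>. There crossing
  \<open>n\<close> alone cuts columns \<open>b\<close> and \<open>Suc b\<close>, and its horizontal
  arcs join them.\<close>

lemma merged_circle:
  assumes last: "\<not> oriented_at L v n"
    and other: "\<And>c. c < n \<Longrightarrow> \<not> oriented_at L v c \<Longrightarrow> Suc (strand (L ! c)) < b"
  shows "merged \<in> circles (b + 1) L v"
  unfolding merged_def
proof (rule columns_circle)
  show "{b, Suc b} \<subseteq> {1..b + 1}" using b_pos by auto
  show "b \<in> {b, Suc b}" by simp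
  show "strand (L ! c) \<in> {b, Suc b} \<longleftrightarrow> Suc (strand (L ! c)) \<in> {b, Suc b}"
    if "c < length L" "\<not> oriented_at L v c" for c
    using that other[of c] by (cases "c = n") (auto simp: length_L)
  have col: "((0, j), (k, j)) \<in> connected_in (b + 1) L v"
    if "j \<in> {b, Suc b}" "k \<le> length L" for j k
  proof (rule column_connected[where c = n])
    show "((i, j), (Suc i, j)) \<in> arcs (b + 1) L v" if "i < length L" "i \<noteq> n" for i
      using that \<open>j \<in> _\<close> other[of i] strand_less[of i] b_pos
      by (intro vertical_arc) (auto simp: length_L)
  qed (use that b_pos in auto)
  \<comment> \<open>The bridge between the two columns is at level \<open>n\<close>; it is carried
    to level 0, where the base point \<open>(0, b)\<close> lies.\<close>
  have "((n, b), (n, Suc b)) \<in> connected_in (b + 1) L v"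
    using horizontal_arcs(1)[of n L v "b + 1"] last by (auto simp: length_L)
  with col[of b n] have "((0, b), (n, Suc b)) \<in> connected_in (b + 1) L v"
    by (auto simp: length_L intro: rtrancl_trans)
  with connected_in_sym[OF col[of "Suc b" n]]
  have step: "((0, b), (0, Suc b)) \<in> connected_in (b + 1) L v"
    by (auto simp: length_L intro: rtrancl_trans)
  show "((0, b), (k, j)) \<in> connected_in (b + 1) L v"
    if "k \<le> length L" "j \<in> {b, Suc b}" for k j
    using that col[of j k] rtrancl_trans[OF step, of "(k, j)"] by auto
qed

lemma circles_adjacent: "circles (b + 1) L adjacent = insert merged (column ` {1..<b})"
proof (rule circles_eqI)
  have "merged \<in> circles (b + 1) L adjacent"
    by (rule merged_circle) (auto simp: oriented_at_adjacent length_L)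
  moreover have "column j \<in> circles (b + 1) L adjacent" if "j \<in> {1..<b}" for j
    using that by (intro column_circle) (auto simp: oriented_at_adjacent)
  ultimately show "insert merged (column ` {1..<b}) \<subseteq> circles (b + 1) L adjacent"
    by blast
  show "cut_points (b + 1) L \<subseteq> \<Union>(insert merged (column ` {1..<b}))"
    by (auto simp: cut_points_def merged_def)
qed

lemma card_circles_adjacent: "card (circles (b + 1) L adjacent) = b"
proof -
  have "card (column ` {1..<b}) = b - 1"
    by (subst card_image) (auto simp: inj_on_def column_eq_iff)
  moreover have "merged \<notin> column ` {1..<b}" using column_neq_merged by blast
  ultimately show ?thesis unfolding circles_adjacent using b_pos by simp
qed

lemma card_circles_oriented_vertex: "card (circles (b + 1) L (oriented_vertex L)) = b + 1"
  unfolding circles_oriented_vertex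
  by (subst card_image) (auto simp: inj_on_def column_eq_iff)

section \<open>Edges leaving the vertex \<open>adjacent\<close>\<close>

lemma edge_map_last: "edge_map (b + 1) L n (adjacent, {}) = frag_of (psi_gen L)"
proof -
  \<comment> \<open>\<open>merged\<close> is the only circle that disappears, which makes this edge
    a split.\<close>
  have "merged \<notin> column ` {1..b + 1}" using column_neq_merged by blast
  then have "circles (b + 1) L adjacent - circles (b + 1) L (insert n adjacent) = {merged}"
    unfolding circles_adjacent insert_adjacent circles_oriented_vertex by auto
  then show ?thesis
    using edge_map_split_minus[of "b + 1" L adjacent n] by (simp add: insert_adjacent psi_gen_def)
qed

text \<open>\<open>c\<close> is a positive crossing of the original braid, and at
  \<open>adjacent\<close> its two strings lie on different circles. The horizontal arc joins them,
  so the edge is a merge.\<close>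

lemma edge_map_other:
  assumes c: "c < n" "c \<notin> adjacent"
  shows "edge_map (b + 1) L c (adjacent, {}) = 0"
proof (rule edge_map_merge_minus)
  define i where "i = strand (L ! c)"
  \<comment> \<open>The circle of \<open>adjacent\<close> through string \<open>Suc i\<close>; for
    \<open>Suc i = b\<close> that string belongs to \<open>merged\<close>. Since
    \<open>i < b\<close>, string \<open>i\<close> always forms a circle of its own.\<close>
  define R where "R = (if Suc i = b then merged else column (Suc i))"
  let ?v = "insert c adjacent"
  note orient = oriented_at_insert_adjacent[OF c(2,1)]
  have i: "1 \<le> i" "i < b" using strand_less[OF c(1)] by (auto simp: i_def)
  have arc: "((c, i), (c, Suc i)) \<in> arcs (b + 1) L ?v"
    unfolding i_def by (rule horizontal_arcs) (use c orient in \<open>auto simp: length_L\<close>)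
  \<comment> \<open>The horizontal arc leads out of \<open>column i\<close> and into
    \<open>R\<close>, so neither remains a full component.\<close>
  have "column i \<notin> circles (b + 1) L ?v"
    using circle_arc_closed[OF _ arc, of "column i"] c by (auto simp: length_L)
  moreover have "R \<notin> circles (b + 1) L ?v"
  proof
    assume R: "R \<in> circles (b + 1) L ?v"
    have "(c, Suc i) \<in> R" using c by (auto simp: R_def merged_def length_L)
    then have "(c, i) \<in> R"
      using circle_eq[OF R] connected_in_sym[OF arc_connected_in[OF arc]] by blast
    then show False using i by (auto simp: R_def merged_def split: if_splits)
  qed
  \<comment> \<open>The circles that avoid strings \<open>i\<close> and \<open>Suc i\<close>
    survive, so exactly two disappear.\<close>
  moreover have merged: "merged \<in> circles (b + 1) L ?v" if "Suc i \<noteq> b"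
    using that i orient by (intro merged_circle) (auto simp: length_L i_def)
  moreover have column: "column j \<in> circles (b + 1) L ?v"
    if "j \<in> {1..<b}" "j \<noteq> i" "j \<noteq> Suc i" for j
    using that orient by (intro column_circle) (auto simp: i_def)
  moreover have "column i \<in> circles (b + 1) L adjacent" "R \<in> circles (b + 1) L adjacent"
    unfolding circles_adjacent R_def using i by auto
  moreover have "C = column i \<or> C = R"
    if C: "C \<in> circles (b + 1) L adjacent" "C \<notin> circles (b + 1) L ?v" for C
  proof -
    consider "C = merged" | j where "j \<in> {1..<b}" "C = column j"
      using C(1) unfolding circles_adjacent by blast
    then show ?thesis
    proof cases
      case 1
      then show ?thesis using merged C(2) by (auto simp: R_def)
    next
      case (2 j)
      then have "j = i \<or> j = Suc i" using column C(2) by blast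
      then show ?thesis using 2 by (auto simp: R_def)
    qed
  qed
  ultimately have "circles (b + 1) L adjacent - circles (b + 1) L ?v = {column i, R}"
    by blast
  moreover have "column i \<noteq> R"
    using column_neq_merged column_eq_iff by (auto simp: R_def)
  ultimately show "card (circles (b + 1) L adjacent - circles (b + 1) L ?v) = 2"
    by simp
qed

lemma differential_adjacent:
  "differential (b + 1) L s (frag_of (adjacent, {})) =
    frag_cmul ((-1) ^ s adjacent n) (frag_of (psi_gen L))"
proof -
  have "n \<in> {..<length L} - adjacent" by (simp add: adjacent_def length_L)
  then have "differential (b + 1) L s (frag_of (adjacent, {})) =
      frag_cmul ((-1) ^ s adjacent n) (edge_map (b + 1) L n (adjacent, {})) +
      (\<Sum>c\<in>{..<length L} - adjacent - {n}.
        frag_cmul ((-1) ^ s adjacent c) (edge_map (b + 1) L c (adjacent, {})))"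
    by (simp add: differential_def frag_extend_of sum.remove del: edge_map.simps)
  also have "(\<Sum>c\<in>{..<length L} - adjacent - {n}.
        frag_cmul ((-1) ^ s adjacent c) (edge_map (b + 1) L c (adjacent, {}))) = 0"
  proof (intro sum.neutral ballI)
    fix c assume "c \<in> {..<length L} - adjacent - {n}"
    then have c: "c < n" "c \<notin> adjacent" by (auto simp: length_L)
    show "frag_cmul ((-1) ^ s adjacent c) (edge_map (b + 1) L c (adjacent, {})) = 0"
      by (simp only: edge_map_other[OF c] frag_cmul_zero2)
  qed
  finally show ?thesis by (simp only: edge_map_last add_0_right)
qed

section \<open>Bidegree of the preimage and the resulting boundary\<close>

lemma adjacent_generator: "(adjacent, {}) \<in> generators (b + 1) L"
  by (auto simp: generators_def vertices_def adjacent_def oriented_vertex_def)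

lemma gr_grading_adjacent: "gr_grading L (adjacent, {}) = psi_gr L - 1"
proof -
  have "finite (oriented_vertex L)" by (simp add: oriented_vertex_def)
  then have "card (oriented_vertex L) = Suc (card adjacent)"
    unfolding adjacent_def using last_in_oriented_vertex by (metis card.remove)
  then show ?thesis by (simp add: psi_gr_def psi_gen_def)
qed

text \<open>All labels are u-, so having one circle fewer raises \<open>p\<close> by one; this
  cancels the drop of \<open>gr\<close> by one.\<close>

lemma q_grading_adjacent: "q_grading (b + 1) L (adjacent, {}) = psi_q (b + 1) L"
  using gr_grading_adjacent card_circles_adjacent card_circles_oriented_vertex
  by (simp add: q_grading_def psi_q_def psi_gr_def psi_gen_def)

lemma psi_gen_boundary:
  "frag_of (psi_gen L) \<in> boundaries (b + 1) L s (psi_gr L) (psi_q (b + 1) L)"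
proof -
  \<comment> \<open>Multiplying by the edge sign in advance makes the image exactly the
    representative of \<open>psi\<close>, since the sign squares to 1.\<close>
  let ?x = "frag_cmul ((-1) ^ s adjacent n) (frag_of (adjacent, {}))"
  have "differential (b + 1) L s ?x =
      frag_cmul ((-1) ^ s adjacent n) (differential (b + 1) L s (frag_of (adjacent, {})))"
    by (simp add: differential_def frag_extend_cmul)
  also have "\<dots> = frag_of (psi_gen L)"
    unfolding differential_adjacent by (simp flip: power_add mult_2)
  finally have "differential (b + 1) L s ?x = frag_of (psi_gen L)" .
  moreover have "?x \<in> carrier (CKh_at (b + 1) L (psi_gr L - 1) (psi_q (b + 1) L))"
    using adjacent_generator gr_grading_adjacent q_grading_adjacent
    by (auto simp: CKh_at_def)
  ultimately show ?thesis unfolding boundaries_def by (metis imageI)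
qed

end

text \<open>The differential is additive, so translation by a boundary maps the boundaries onto
  themselves: sums give one inclusion, differences the other.\<close>

lemma r_coset_boundaries:
  assumes a: "a \<in> boundaries b w s i q"
  shows "boundaries b w s i q #>\<^bsub>CKh_at b w i q\<^esub> a = boundaries b w s i q"
    (is "?B #>\<^bsub>_\<^esub> a = ?B")
proof -
  obtain x where x: "x \<in> carrier (CKh_at b w (i - 1) q)" "a = differential b w s x"
    using a by (auto simp: boundaries_def)
  have add: "differential b w s y + a \<in> ?B"
    if "y \<in> carrier (CKh_at b w (i - 1) q)" for y
  proof -
    have "differential b w s y + a = differential b w s (y + x)"
      by (simp add: x(2) differential_def frag_extend_add)
    moreover have "y + x \<in> carrier (CKh_at b w (i - 1) q)"
      using that x(1) keys_add[of y x] by (auto simp: CKh_at_def)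
    ultimately show ?thesis by (simp add: boundaries_def)
  qed
  have diff: "differential b w s y - a \<in> ?B"
    if "y \<in> carrier (CKh_at b w (i - 1) q)" for y
  proof -
    have "differential b w s y - a = differential b w s (y - x)"
      by (simp add: x(2) differential_def frag_extend_diff)
    moreover have "y - x \<in> carrier (CKh_at b w (i - 1) q)"
      using that x(1) keys_diff[of y x] by (auto simp: CKh_at_def)
    ultimately show ?thesis by (simp add: boundaries_def)
  qed
  have coset: "?B #>\<^bsub>CKh_at b w i q\<^esub> a = (\<lambda>h. h + a) ` ?B"
    by (auto simp: r_coset_def CKh_at_def)
  show ?thesis
    unfolding coset
  proof (intro equalityI subsetI)
    fix z assume "z \<in> ?B"
    then have "z - a \<in> ?B" using diff by (auto simp: boundaries_def)
    then show "z \<in> (\<lambda>h. h + a) ` ?B" by (rule rev_image_eqI) simp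
  next
    fix z assume "z \<in> (\<lambda>h. h + a) ` ?B"
    then show "z \<in> ?B" using add by (auto simp: boundaries_def)
  qed
qed

theorem theorem3:
  fixes b :: nat and w L :: braid_word and s :: "nat set \<Rightarrow> nat \<Rightarrow> nat"
  assumes "braid_word_on b w"
    and "L = negative_stabilization b w"
    and "sign_choice (b + 1) L s"
  shows "psi (b + 1) L s = \<one>\<^bsub>Kh (b + 1) L s (psi_gr L) (psi_q (b + 1) L)\<^esub>"
proof -
  interpret stabilization b w L
    using assms(1,2) by unfold_locales
  \<comment> \<open>The identity of the factor group is the set of boundaries itself, so it suffices
    that the coset of the representative is trivial.\<close>
  show ?thesis
    using r_coset_boundaries[OF psi_gen_boundary]
    by (simp add: psi_def Kh_def FactGroup_def)
qed

end
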